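(* Let $G=(V,E)$ be a finite strongly connected digraph with at least one edge (loops and multiple edges allowed), and for each vertex fix an arbitrary cyclic ordering of the edges emanating from it. Let $(v_i)_{i=0}^{\infty}$ be a rotor walk on $G$, that is, the sequence of consecutive chip locations obtained by iterating the rotor-router operation from some state. Then for every $v\in V$ the limit below exists and $$\lim_{t\to\infty}\frac{1}{t}\,\bigl|\{\,0\le i\le t-1 : v_i=v\,\}\bigr| \;=\; \frac{\mathcal{T}_G(v)\deg_G^{+}(v)}{\sum_{w\in V}\mathcal{T}_G(w)\deg_G^{+}(w)},$$ where $\deg_G^{+}(v)$ is the outdegree of $v$ and $\mathcal{T}_G(v)$ is the number of oriented spanning trees of $G$ rooted at $v$. Moreover, this frequency coincides with the stationary distribution of the simple random walk on $G$ evaluated at $v$.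
   Context: Digraphs may have loops and multi-edges (parallel edges are distinct edges); $\deg_G^{+}(v)$ counts all edges with tail $v$, including loops. An oriented spanning tree of $G$ rooted at $s\in V$ is a spanning subgraph $T$ (identified with its edge set) such that $s$ has outdegree $0$ in $T$ and every vertex $v$ has a unique path in $T$ to $s$. Rotor-router operation: for each vertex $v$ the set of edges emanating from $v$ is equipped with a cyclic ordering, and $e^{+}$ denotes the edge following $e$ in the cyclic ordering at the tail of $e$. A rotor configuration is a map $\rho:V\to E$ such that $\rho(v)$ is an edge emanating from $v$ for each $v$. A state is a pair $(v,\rho)$ with $v\in V$ (the location of the chip) and $\rho$ a rotor configuration. The rotor-router operation sends $(v,\rho)$ to $(v',\rho')$, where $\rho'(v)=\rho(v)^{+}$, $\rho'(u)=\rho(u)$ for $u\ne v$, and $v'$ is the head of $\rho'(v)$. The simple random walk on $G$ is the Markov chain on $V$ which, from a vertex $v$, chooses an edge emanating from $v$ uniformly at random and moves to its head; its stationary distribution is the unique probability distribution on $V$ invariant under this chain. *)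

theory Defs
  imports
    "HOL-Probability.Probability_Mass_Function"
    "HOL-Combinatorics.Orbits"
    "Graph_Theory.Digraph_Component"
begin

(* "Path" is a directed walk here (awalk).  Uniqueness among vertex-simple paths (apath) would be
   too weak: adding a loop at a non-root vertex of a tree creates no new simple path to the root. *)
definition oriented_spanning_tree ::
    "('a, 'b) pre_digraph \<Rightarrow> 'a \<Rightarrow> ('a, 'b) pre_digraph \<Rightarrow> bool" where
  "oriented_spanning_tree G s T \<longleftrightarrow>
     spanning T G \<and> out_degree T s = 0 \<and>
     (\<forall>v \<in> verts G. \<exists>!p. pre_digraph.awalk T v p s)"

(* A subgraph in the library's sense shares the tail and head functions of G, so a spanning
   subgraph T is determined by its arc set and this counts arc sets. *)
definition num_oriented_spanning_trees :: "('a, 'b) pre_digraph \<Rightarrow> 'a \<Rightarrow> nat" where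
  "num_oriented_spanning_trees G s = card {T. oriented_spanning_tree G s T}"

(* A cyclic ordering of the edges emanating from each vertex, given by its successor map:
   "next_arc e" is the edge following e among the edges with the same tail. *)
definition rotor_order :: "('a, 'b) pre_digraph \<Rightarrow> ('b \<Rightarrow> 'b) \<Rightarrow> bool" where
  "rotor_order G next_arc \<longleftrightarrow> (\<forall>v \<in> verts G. cyclic_on next_arc (out_arcs G v))"

definition rotor_config :: "('a, 'b) pre_digraph \<Rightarrow> ('a \<Rightarrow> 'b) \<Rightarrow> bool" where
  "rotor_config G \<rho> \<longleftrightarrow> (\<forall>v \<in> verts G. \<rho> v \<in> out_arcs G v)"

type_synonym ('a, 'b) rotor_state = "'a \<times> ('a \<Rightarrow> 'b)"

definition rotor_states :: "('a, 'b) pre_digraph \<Rightarrow> ('a, 'b) rotor_state set" where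
  "rotor_states G = {(v, \<rho>). v \<in> verts G \<and> rotor_config G \<rho>}"

definition rotor_step ::
    "('a, 'b) pre_digraph \<Rightarrow> ('b \<Rightarrow> 'b) \<Rightarrow> ('a, 'b) rotor_state \<Rightarrow> ('a, 'b) rotor_state" where
  "rotor_step G next_arc = (\<lambda>(v, \<rho>). let \<rho>' = \<rho>(v := next_arc (\<rho> v)) in (head G (\<rho>' v), \<rho>'))"

definition rotor_walk :: "('a, 'b) pre_digraph \<Rightarrow> ('b \<Rightarrow> 'b) \<Rightarrow> (nat \<Rightarrow> 'a) \<Rightarrow> bool" where
  "rotor_walk G next_arc x \<longleftrightarrow>
     (\<exists>\<sigma> \<in> rotor_states G. \<forall>i. x i = fst ((rotor_step G next_arc ^^ i) \<sigma>))"

(* Only meaningful at vertices with at least one outgoing edge. *)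
definition srw_kernel :: "('a, 'b) pre_digraph \<Rightarrow> 'a \<Rightarrow> 'a pmf" where
  "srw_kernel G v = map_pmf (head G) (pmf_of_set (out_arcs G v))"

definition srw_invariant :: "('a, 'b) pre_digraph \<Rightarrow> 'a pmf \<Rightarrow> bool" where
  "srw_invariant G \<pi> \<longleftrightarrow> set_pmf \<pi> \<subseteq> verts G \<and> bind_pmf \<pi> (srw_kernel G) = \<pi>"

definition srw_stationary :: "('a, 'b) pre_digraph \<Rightarrow> 'a pmf" where
  "srw_stationary G = (THE \<pi>. srw_invariant G \<pi>)"

end

theory Submission
  imports Defs
begin

text \<open>
  Write \<open>T v\<close> for the number of spanning trees rooted at \<open>v\<close> and \<open>d v\<close> for the outdegree. Let
  \<open>N v\<close> be the number of visits to \<open>v\<close> during the first \<open>t\<close> steps. A rotor distributes the chip as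
  evenly as possible: each arc leaving \<open>v\<close> is used \<open>N v / d v + O(1)\<close> times. Counting arrivals at
  \<open>w\<close>, the function \<open>a = N / d\<close> therefore satisfies the balance equations
  \<open>d w * a w = (\<Sum>e into w. a (tail e))\<close> up to a bounded error that does not depend on \<open>t\<close>. For the
  same reason \<open>\<pi> / d\<close> satisfies them exactly if \<open>\<pi>\<close> is an invariant distribution of the simple
  random walk.

  The function \<open>T\<close> is an exact positive solution (\<open>tree_balance\<close>, the Markov chain tree theorem).
  To see this, count the functions that choose an arc at every vertex in such a way that following
  the chosen arcs leads from every vertex to \<open>v\<close>. Such a function traces a single cycle, through
  \<open>v\<close>. Deleting the arc of the cycle that leaves \<open>v\<close> gives a tree rooted at \<open>v\<close>, and deleting the arc
  \<open>e\<close> of the cycle that enters \<open>v\<close> gives a tree rooted at the tail of \<open>e\<close>. Either way the pair of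
  tree and arc determines the function, so the two counts are the two sides of the balance equation.

  Solutions are stable up to scaling. Subtract \<open>a\<close> from the smallest multiple \<open>M * T\<close> that
  dominates it. The difference is nonnegative, vanishes somewhere, and is superharmonic up to the
  error; by a Harnack inequality along paths (\<open>harnack\<close>) it is everywhere bounded by a constant times
  the error. Hence \<open>d * a\<close> is proportional to \<open>d * T\<close> up to a bounded multiple of the error
  (\<open>almost_subharmonic_near_tree_freq\<close>). With error 0 this is uniqueness of the invariant distribution
  and its formula; with bounded error it says that \<open>N v\<close> differs from \<open>t\<close> times the tree frequency by
  \<open>O(1)\<close>, which is stronger than the limit.
\<close>

section \<open>Iterating a map\<close>

lemma funpow_Suc_apply: "(g ^^ Suc n) u = (g ^^ n) (g u)"
  by (simp add: funpow_swap1)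

text \<open>
  The first passages from \<open>v\<close> to \<open>w\<close> and to \<open>w'\<close> take equally long: if one were longer, it
  would pass \<open>v\<close> again after the shorter one, and could be shortened.
\<close>
lemma funpow_cycle_pred_unique:
  fixes g :: "'x \<Rightarrow> 'x"
  assumes "(g ^^ m) v = w" "(g ^^ n) v = w'" "g w = v" "g w' = v"
  shows "w = w'"
proof -
  define a where "a = (LEAST n. (g ^^ n) v = w)"
  define b where "b = (LEAST n. (g ^^ n) v = w')"
  have a: "(g ^^ a) v = w" unfolding a_def using assms(1) by (rule LeastI)
  have b: "(g ^^ b) v = w'" unfolding b_def using assms(2) by (rule LeastI)
  have cyc: "(g ^^ (j - Suc i)) v = (g ^^ j) v" if "i < j" "g ((g ^^ i) v) = v" for i j
  proof -
    have "j = (j - Suc i) + Suc i" using that by simp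
    then have "(g ^^ j) v = (g ^^ (j - Suc i)) ((g ^^ Suc i) v)"
      by (metis funpow_add o_apply)
    then show ?thesis using that by simp
  qed
  have "\<not> a < b"
  proof
    assume *: "a < b"
    then have "(g ^^ (b - Suc a)) v = w'" using cyc[OF *] a b assms(3) by simp
    then have "b \<le> b - Suc a" unfolding b_def by (rule Least_le)
    with * show False by simp
  qed
  moreover have "\<not> b < a"
  proof
    assume *: "b < a"
    then have "(g ^^ (a - Suc b)) v = w" using cyc[OF *] a b assms(4) by simp
    then have "a \<le> a - Suc b" unfolding a_def by (rule Least_le)
    with * show False by simp
  qed
  ultimately have "a = b" by simp
  with a b show ?thesis by simp
qed

section \<open>Strongly connected digraphs\<close>

locale strong_digraph = fin_digraph G for G :: "('a, 'b) pre_digraph" +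
  assumes strongly_connected: "strongly_connected G"
    and arcs_nonempty: "arcs G \<noteq> {}"
begin

lemma out_arcs_nonempty:
  assumes "v \<in> verts G"
  shows "out_arcs G v \<noteq> {}"
proof -
  obtain e where e: "e \<in> arcs G"
    using arcs_nonempty by blast
  then have "v \<rightarrow>\<^sup>*\<^bsub>G\<^esub> tail G e"
    using strongly_connected assms by (auto simp: strongly_connected_def)
  then obtain p where p: "awalk v p (tail G e)"
    by (auto simp: reachable_awalk)
  show ?thesis
  proof (cases p)
    case Nil
    with p have "v = tail G e" by (simp add: awalk_Nil_iff)
    with e show ?thesis by (auto simp: out_arcs_def)
  next
    case (Cons a q)
    with p show ?thesis by (auto simp: awalk_Cons_iff out_arcs_def)
  qed
qed

lemma out_degree_pos: "v \<in> verts G \<Longrightarrow> out_degree G v > 0"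
  using out_arcs_nonempty by (auto simp: out_degree_def card_gt_0_iff)

section \<open>Counting trees by unicycles\<close>

text \<open>
  A function in this set is the arc set of a functional digraph with exactly one cycle, which goes
  through \<open>v\<close>.
\<close>
definition unicycles :: "'a \<Rightarrow> ('a \<Rightarrow> 'b) set" where
  "unicycles v = {f \<in> Pi\<^sub>E (verts G) (out_arcs G).
     \<forall>u \<in> verts G. \<exists>n. ((\<lambda>u. head G (f u)) ^^ n) u = v}"

lemma finite_unicycles: "finite (unicycles v)"
proof (rule finite_subset)
  show "unicycles v \<subseteq> Pi\<^sub>E (verts G) (out_arcs G)" by (auto simp: unicycles_def)
qed (auto intro!: finite_PiE)

lemma unicyclesD:
  assumes "f \<in> unicycles w" "u \<in> verts G"
  shows "f u \<in> arcs G" "tail G (f u) = u" "head G (f u) \<in> verts G"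
    "\<exists>n. ((\<lambda>u. head G (f u)) ^^ n) u = w"
  using assms by (auto simp: unicycles_def PiE_iff)

definition tree_of :: "'a \<Rightarrow> ('a \<Rightarrow> 'b) \<Rightarrow> ('a, 'b) pre_digraph" where
  "tree_of w f = G\<lparr>arcs := f ` (verts G - {w})\<rparr>"

lemma tree_of_sel [simp]:
  "verts (tree_of w f) = verts G" "arcs (tree_of w f) = f ` (verts G - {w})"
  "tail (tree_of w f) = tail G" "head (tree_of w f) = head G"
  by (simp_all add: tree_of_def)

text \<open>
  Every non-root vertex has a single outgoing arc in the subgraph, so a walk to the root has no
  choice; it stops because the root has outdegree 0.
\<close>
lemma oriented_spanning_tree_tree_of:
  assumes w: "w \<in> verts G" and f: "f \<in> unicycles w"
  shows "oriented_spanning_tree G w (tree_of w f)"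
proof -
  let ?T = "tree_of w f"
  interpret T: wf_digraph ?T
    by unfold_locales (auto simp: unicyclesD[OF f])
  have sp: "spanning ?T G"
    using wf_digraph_axioms T.wf_digraph_axioms unicyclesD[OF f]
    by (auto simp: spanning_def subgraph_def compatible_def)
  have out: "out_arcs ?T w = {}"
    using unicyclesD[OF f] by (auto simp: out_arcs_def)
  have ex: "\<exists>p. T.awalk u p w" if "((\<lambda>u. head G (f u)) ^^ n) u = w" "u \<in> verts G" for n u
    using that
  proof (induction n arbitrary: u)
    case 0
    then have "T.awalk u [] w" by (simp add: T.awalk_Nil_iff)
    then show ?case by blast
  next
    case (Suc n)
    show ?case
    proof (cases "u = w")
      case True
      then have "T.awalk u [] w" using w by (simp add: T.awalk_Nil_iff)
      then show ?thesis by blast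
    next
      case False
      have "((\<lambda>u. head G (f u)) ^^ n) (head G (f u)) = w"
        using Suc.prems(1) by (simp only: funpow_Suc_apply)
      then obtain p where "T.awalk (head G (f u)) p w"
        using Suc.IH unicyclesD[OF f Suc.prems(2)] by blast
      then have "T.awalk u (f u # p) w"
        using False Suc.prems(2) unicyclesD[OF f Suc.prems(2)] by (auto simp: T.awalk_Cons_iff)
      then show ?thesis by blast
    qed
  qed
  have arc: "e = f u \<and> u \<noteq> w" if "e \<in> arcs ?T" "tail G e = u" for e u
    using that unicyclesD[OF f] by auto
  have uniq: "p = q" if "T.awalk u p w" "T.awalk u q w" for u p q
    using that
  proof (induction p arbitrary: u q)
    case Nil
    then have "u = w" by (simp add: T.awalk_Nil_iff)
    with Nil.prems(2) have "T.awalk w q w" by simp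
    with arc[of _ w] show ?case
      by (cases q) (auto simp: T.awalk_Cons_iff simp del: tree_of_sel(2))
  next
    case (Cons e p)
    then have e: "e = f u" "u \<noteq> w" "T.awalk (head G e) p w"
      using arc[of e u] by (auto simp: T.awalk_Cons_iff simp del: tree_of_sel(2))
    then obtain e' q' where q: "q = e' # q'"
      using Cons.prems(2) by (cases q) (auto simp: T.awalk_Nil_iff)
    then have "e' = f u" "T.awalk (head G e') q' w"
      using arc[of e' u] Cons.prems(2) by (auto simp: T.awalk_Cons_iff simp del: tree_of_sel(2))
    with q e Cons.IH show ?case by auto
  qed
  have "\<exists>!p. T.awalk u p w" if "u \<in> verts G" for u
    using ex unicyclesD(4)[OF f that] that uniq by metis
  with sp out show ?thesis
    by (simp add: oriented_spanning_tree_def out_degree_def)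
qed

text \<open>
  In a tree, two distinct arcs out of one vertex would extend to two distinct walks to the root.
  Hence the tree is a choice of one arc at each non-root vertex, and \<open>e\<close> completes it at the root.
\<close>
lemma ex_unicycle_tree_of:
  assumes w: "w \<in> verts G" and e: "e \<in> out_arcs G w" and T: "oriented_spanning_tree G w T"
  obtains f where "f \<in> unicycles w" "f w = e" "tree_of w f = T"
proof -
  from T have sp: "verts T = verts G" "arcs T \<subseteq> arcs G" "tail T = tail G" "head T = head G"
      "wf_digraph T"
    and ex1: "\<And>u. u \<in> verts G \<Longrightarrow> \<exists>!p. pre_digraph.awalk T u p w" and deg: "out_degree T w = 0"
    by (auto simp: oriented_spanning_tree_def spanning_def subgraph_def compatible_def)
  interpret T: wf_digraph T by fact
  have "finite (out_arcs T w)"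
    using sp(2) finite_arcs by (auto simp: out_arcs_def intro: finite_subset)
  with deg have root: "tail G a \<noteq> w" if "a \<in> arcs T" for a
    using that sp by (auto simp: out_degree_def out_arcs_def)
  have ex_arc: "\<exists>a. a \<in> arcs T \<and> tail G a = u" if u: "u \<in> verts G" "u \<noteq> w" for u
  proof -
    obtain p where "T.awalk u p w" using ex1[OF u(1)] by blast
    with u show ?thesis
      by (cases p) (auto simp: T.awalk_Nil_iff T.awalk_Cons_iff sp)
  qed
  have arc_unique: "a = b" if "a \<in> arcs T" "b \<in> arcs T" "tail G a = tail G b" for a b
  proof -
    have verts: "head G a \<in> verts G" "head G b \<in> verts G" "tail G a \<in> verts G"
      using that sp by (auto intro: wellformed)
    obtain p where p: "T.awalk (head G a) p w"
      using ex1[OF verts(1)] by blast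
    obtain q where q: "T.awalk (head G b) q w"
      using ex1[OF verts(2)] by blast
    have "T.awalk (tail G a) (a # p) w" "T.awalk (tail G a) (b # q) w"
      using that p q by (simp_all add: T.awalk_Cons_iff sp)
    then have "a # p = b # q" using ex1[OF verts(3)] by blast
    then show ?thesis by simp
  qed
  define h where "h u = (SOME a. a \<in> arcs T \<and> tail G a = u)" for u
  have h: "h u \<in> arcs T" "tail G (h u) = u" if "u \<in> verts G" "u \<noteq> w" for u
    using someI_ex[OF ex_arc[OF that]] by (auto simp: h_def)
  define f where "f = restrict (h(w := e)) (verts G)"
  have fh: "f u = h u" if "u \<in> verts G" "u \<noteq> w" for u using that by (simp add: f_def)
  have fw: "f w = e" using w by (simp add: f_def)
  have f_arc: "f (tail G a) = a" if "a \<in> arcs T" for a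
  proof -
    have "tail G a \<in> verts G" "tail G a \<noteq> w" using that sp root by auto
    then show ?thesis using h fh arc_unique that by simp
  qed
  have "f \<in> Pi\<^sub>E (verts G) (out_arcs G)"
    using h(1)[THEN subsetD[OF sp(2)]] h(2) e by (auto simp: f_def)
  moreover have "\<exists>n. ((\<lambda>u. head G (f u)) ^^ n) u = w" if "T.awalk u p w" for u p
    using that
  proof (induction p arbitrary: u)
    case Nil
    then have "((\<lambda>u. head G (f u)) ^^ 0) u = w" by (simp add: T.awalk_Nil_iff)
    then show ?case by blast
  next
    case (Cons a p)
    then have a: "a \<in> arcs T" "u = tail G a" "T.awalk (head G a) p w"
      by (auto simp: T.awalk_Cons_iff sp)
    then obtain n where "((\<lambda>u. head G (f u)) ^^ n) (head G a) = w"
      using Cons.IH by blast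
    then have "((\<lambda>u. head G (f u)) ^^ Suc n) u = w"
      using f_arc[OF a(1)] a(2) by (simp only: funpow_Suc_apply)
    then show ?case by blast
  qed
  then have "\<exists>n. ((\<lambda>u. head G (f u)) ^^ n) u = w" if "u \<in> verts G" for u
    using ex1[OF that] by blast
  ultimately have "f \<in> unicycles w"
    by (auto simp: unicycles_def)
  moreover have "f ` (verts G - {w}) = arcs T"
  proof
    show "f ` (verts G - {w}) \<subseteq> arcs T" using h fh by auto
    show "arcs T \<subseteq> f ` (verts G - {w})"
    proof
      fix a assume a: "a \<in> arcs T"
      then have "tail G a \<in> verts G - {w}" using root sp by auto
      with f_arc[OF a] show "a \<in> f ` (verts G - {w})" by (metis imageI)
    qed
  qed
  then have "tree_of w f = T"
    using sp by (simp add: tree_of_def)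
  ultimately show ?thesis using that fw by blast
qed

lemma card_unicycles_fixed_arc:
  assumes "e \<in> arcs G"
  shows "card {f \<in> unicycles (tail G e). f (tail G e) = e} = num_oriented_spanning_trees G (tail G e)"
proof -
  define w where "w = tail G e"
  have w: "w \<in> verts G" "e \<in> out_arcs G w" using assms by (auto simp: w_def)
  have inj: "inj_on (tree_of w) {f \<in> unicycles w. f w = e}"
  proof (rule inj_onI)
    fix f f' assume *: "f \<in> {f \<in> unicycles w. f w = e}" "f' \<in> {f \<in> unicycles w. f w = e}"
      and eq: "tree_of w f = tree_of w f'"
    then have f: "f \<in> unicycles w" and f': "f' \<in> unicycles w" by auto
    show "f = f'"
    proof
      fix u
      show "f u = f' u"
      proof (cases "u \<in> verts G \<and> u \<noteq> w")
        case True
        then have "f u \<in> f' ` (verts G - {w})"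
          using eq by (metis tree_of_sel(2) DiffI imageI singletonD)
        then obtain u' where u': "u' \<in> verts G" "f u = f' u'" by blast
        then have "u' = u" using unicyclesD(2)[OF f] unicyclesD(2)[OF f'] True by metis
        with u' show ?thesis by simp
      next
        case False
        then show ?thesis using * by (auto simp: unicycles_def PiE_iff extensional_def)
      qed
    qed
  qed
  have img: "tree_of w ` {f \<in> unicycles w. f w = e} = {T. oriented_spanning_tree G w T}"
  proof (intro equalityI subsetI)
    fix T assume "T \<in> {T. oriented_spanning_tree G w T}"
    then obtain f where "f \<in> unicycles w" "f w = e" "tree_of w f = T"
      using ex_unicycle_tree_of[OF w] by blast
    then show "T \<in> tree_of w ` {f \<in> unicycles w. f w = e}" by blast
  qed (use oriented_spanning_tree_tree_of[OF w(1)] in auto)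
  show ?thesis
    using card_image[OF inj] by (simp add: img num_oriented_spanning_trees_def flip: w_def)
qed

text \<open>
  The common part of the two counts: \<open>A\<close> lists the possible values of a designated arc of the
  cycle, and each such arc \<open>e\<close> is left with the trees rooted at its tail.
\<close>
lemma card_unicycles_eq_sum_arcs:
  assumes "finite A" "A \<subseteq> arcs G"
    and dec: "\<And>f. f \<in> unicycles v \<longleftrightarrow> (\<exists>e\<in>A. f \<in> unicycles (tail G e) \<and> f (tail G e) = e)"
    and disj: "\<And>f e e'. \<lbrakk>e \<in> A; e' \<in> A; f \<in> unicycles (tail G e); f (tail G e) = e;
      f \<in> unicycles (tail G e'); f (tail G e') = e'\<rbrakk> \<Longrightarrow> e = e'"
  shows "card (unicycles v) = (\<Sum>e\<in>A. num_oriented_spanning_trees G (tail G e))"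
proof -
  let ?U = "\<lambda>e. {f \<in> unicycles (tail G e). f (tail G e) = e}"
  have "unicycles v = (\<Union>e\<in>A. ?U e)" using dec by blast
  also have "card \<dots> = (\<Sum>e\<in>A. card (?U e))"
  proof (rule card_UN_disjoint)
    show "finite A" by fact
    show "\<forall>e\<in>A. finite (?U e)" using finite_unicycles by simp
    show "\<forall>e\<in>A. \<forall>e'\<in>A. e \<noteq> e' \<longrightarrow> ?U e \<inter> ?U e' = {}" using disj by blast
  qed
  also have "\<dots> = (\<Sum>e\<in>A. num_oriented_spanning_trees G (tail G e))"
    using card_unicycles_fixed_arc assms(2) by (intro sum.cong) auto
  finally show ?thesis .
qed

text \<open>
  The designated arc is the arc of the cycle that leaves \<open>v\<close>.
\<close>
lemma card_unicycles_out:
  assumes "v \<in> verts G"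
  shows "card (unicycles v) = num_oriented_spanning_trees G v * out_degree G v"
proof -
  have "card (unicycles v) = (\<Sum>e\<in>out_arcs G v. num_oriented_spanning_trees G (tail G e))"
  proof (rule card_unicycles_eq_sum_arcs)
    show "f \<in> unicycles v \<longleftrightarrow> (\<exists>e\<in>out_arcs G v. f \<in> unicycles (tail G e) \<and> f (tail G e) = e)" for f
      using unicyclesD[of f v v] assms by auto
  qed auto
  then show ?thesis by (simp add: out_degree_def)
qed

text \<open>
  The designated arc is the arc of the cycle that enters \<open>v\<close>. Its tail
  \<open>w\<close> is the predecessor of \<open>v\<close> on the cycle, so every vertex leads to \<open>w\<close> as well. Conversely,
  if every vertex leads to \<open>w\<close> and the arc chosen at \<open>w\<close> enters \<open>v\<close>, then every vertex leads to \<open>v\<close>.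
\<close>
lemma card_unicycles_in:
  assumes "v \<in> verts G"
  shows "card (unicycles v) = (\<Sum>e\<in>in_arcs G v. num_oriented_spanning_trees G (tail G e))"
proof (rule card_unicycles_eq_sum_arcs)
  fix f :: "'a \<Rightarrow> 'b"
  let ?g = "\<lambda>u. head G (f u)"
  show "f \<in> unicycles v \<longleftrightarrow> (\<exists>e\<in>in_arcs G v. f \<in> unicycles (tail G e) \<and> f (tail G e) = e)"
  proof
    assume f: "f \<in> unicycles v"
    obtain n where n: "(?g ^^ n) (?g v) = v" using unicyclesD(4)[OF f] unicyclesD(3)[OF f assms] by blast
    \<comment> \<open>The length of the cycle through \<open>v\<close> divides \<open>n + 1\<close>, so \<open>w\<close> precedes \<open>v\<close> on it.\<close>
    define w where "w = (?g ^^ n) v"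
    have "(?g ^^ Suc n) v = v" using n by (simp only: funpow_Suc_apply)
    then have gw: "?g w = v" by (simp add: w_def)
    have "(?g ^^ k) v \<in> verts G" for k using unicyclesD(3)[OF f] assms by (induction k) auto
    then have w: "w \<in> verts G" by (simp add: w_def)
    have "\<exists>m. (?g ^^ m) u = w" if u: "u \<in> verts G" for u
    proof -
      obtain k where "(?g ^^ k) u = v" using unicyclesD(4)[OF f u] by blast
      then have "(?g ^^ (n + k)) u = w" by (simp add: funpow_add w_def)
      then show ?thesis by blast
    qed
    then have "f \<in> unicycles w" using f by (auto simp: unicycles_def)
    with gw unicyclesD[OF f w]
    have "f w \<in> in_arcs G v \<and> f \<in> unicycles (tail G (f w)) \<and> f (tail G (f w)) = f w" by simp
    then show "\<exists>e\<in>in_arcs G v. f \<in> unicycles (tail G e) \<and> f (tail G e) = e" by blast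
  next
    assume "\<exists>e\<in>in_arcs G v. f \<in> unicycles (tail G e) \<and> f (tail G e) = e"
    then obtain e where e: "head G e = v" and f: "f \<in> unicycles (tail G e)" "f (tail G e) = e"
      by auto
    have "\<exists>m. (?g ^^ m) u = v" if u: "u \<in> verts G" for u
    proof -
      obtain k where "(?g ^^ k) u = tail G e" using unicyclesD(4)[OF f(1) u] by blast
      then have "(?g ^^ Suc k) u = v" using e f by simp
      then show ?thesis by blast
    qed
    then show "f \<in> unicycles v" using f by (auto simp: unicycles_def)
  qed
next
  fix f e e'
  assume "e \<in> in_arcs G v" "e' \<in> in_arcs G v" and f: "f \<in> unicycles (tail G e)" "f (tail G e) = e"
    and f': "f \<in> unicycles (tail G e')" "f (tail G e') = e'"
  then have heads: "head G (f (tail G e)) = v" "head G (f (tail G e')) = v" by auto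
  obtain m where m: "((\<lambda>u. head G (f u)) ^^ m) v = tail G e"
    using unicyclesD(4)[OF f(1) assms] ..
  obtain n where n: "((\<lambda>u. head G (f u)) ^^ n) v = tail G e'"
    using unicyclesD(4)[OF f'(1) assms] ..
  have "tail G e = tail G e'"
    by (rule funpow_cycle_pred_unique[where g = "\<lambda>u. head G (f u)", OF m n heads])
  then have "f (tail G e) = f (tail G e')" by (rule arg_cong)
  then show "e = e'" by (simp only: f(2) f'(2))
qed (auto simp: in_arcs_def)

text \<open>
  The Markov chain tree theorem, as a balance equation.
\<close>
lemma tree_balance:
  assumes "v \<in> verts G"
  shows "num_oriented_spanning_trees G v * out_degree G v
    = (\<Sum>e\<in>in_arcs G v. num_oriented_spanning_trees G (tail G e))"
  using card_unicycles_out card_unicycles_in assms by simp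

text \<open>
  Let every vertex choose an arc that decreases the distance to \<open>v\<close>.
\<close>
lemma unicycles_nonempty:
  assumes v: "v \<in> verts G"
  shows "unicycles v \<noteq> {}"
proof -
  define dist where "dist u = (LEAST n. \<exists>p. awalk u p v \<and> length p = n)" for u
  have ex: "\<exists>n p. awalk u p v \<and> length p = n" if "u \<in> verts G" for u
  proof -
    have "u \<rightarrow>\<^sup>*\<^bsub>G\<^esub> v" using strongly_connected that v by (auto simp: strongly_connected_def)
    then show ?thesis by (simp add: reachable_awalk)
  qed
  have closer: "\<exists>e\<in>out_arcs G u. u \<noteq> v \<longrightarrow> dist (head G e) < dist u" if u: "u \<in> verts G" for u
  proof (cases "u = v")
    case True
    then show ?thesis using out_arcs_nonempty[OF u] by blast
  next
    case False
    obtain p where p: "awalk u p v" "length p = dist u"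
      using LeastI_ex[OF ex[OF u]] unfolding dist_def by blast
    with False obtain e q where q: "p = e # q" by (cases p) (auto simp: awalk_Nil_iff)
    then have e: "e \<in> out_arcs G u" "awalk (head G e) q v" using p by (auto simp: awalk_Cons_iff)
    then have "dist (head G e) \<le> length q" unfolding dist_def by (intro Least_le) blast
    also have "\<dots> < dist u" using p(2) q by simp
    finally show ?thesis using e(1) by blast
  qed
  then obtain h where h: "\<And>u. u \<in> verts G \<Longrightarrow> h u \<in> out_arcs G u \<and> (u \<noteq> v \<longrightarrow> dist (head G (h u)) < dist u)"
    by metis
  define f where "f = restrict h (verts G)"
  have "\<exists>n. ((\<lambda>u. head G (f u)) ^^ n) u = v" if "u \<in> verts G" for u
    using that
  proof (induction "dist u" arbitrary: u rule: less_induct)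
    case less
    show ?case
    proof (cases "u = v")
      case True
      then have "((\<lambda>u. head G (f u)) ^^ 0) u = v" by simp
      then show ?thesis by blast
    next
      case False
      then have "head G (f u) \<in> verts G" "dist (head G (f u)) < dist u"
        using h[OF less.prems] less.prems by (auto simp: f_def)
      then obtain n where "((\<lambda>u. head G (f u)) ^^ n) (head G (f u)) = v"
        using less.hyps by blast
      then have "((\<lambda>u. head G (f u)) ^^ Suc n) u = v" by (simp only: funpow_Suc_apply)
      then show ?thesis by blast
    qed
  qed
  moreover have "f \<in> Pi\<^sub>E (verts G) (out_arcs G)" using h by (auto simp: f_def)
  ultimately have "f \<in> unicycles v" by (simp add: unicycles_def)
  then show ?thesis by blast
qed

lemma num_oriented_spanning_trees_pos:
  assumes "v \<in> verts G"
  shows "num_oriented_spanning_trees G v > 0"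
  using card_unicycles_out[OF assms] unicycles_nonempty[OF assms] finite_unicycles[of v]
  by (metis card_gt_0_iff mult_is_0 neq0_conv)

section \<open>A Harnack inequality\<close>

text \<open>
  With mass \<open>d * g\<close> on the vertices, one step of the simple random walk raises the mass at no
  vertex by more than \<open>C\<close>.
\<close>
definition almost_superharmonic :: "real \<Rightarrow> ('a \<Rightarrow> real) \<Rightarrow> bool" where
  "almost_superharmonic C g \<longleftrightarrow> (\<forall>v\<in>verts G. 0 \<le> g v \<and>
     (\<Sum>e\<in>in_arcs G v. g (tail G e)) \<le> real (out_degree G v) * g v + C)"

text \<open>
  Along an arc from \<open>x\<close> to \<open>y\<close>, the value at \<open>x\<close> is one of the nonnegative terms of the sum at
  \<open>y\<close>, whence \<open>g x \<le> d y * g y + C\<close>; iterate along a path. The constant must not depend on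
  \<open>g\<close>, since it will be applied to a different function for each time \<open>t\<close>.
\<close>
lemma harnack_pair:
  assumes "u \<rightarrow>\<^sup>*\<^bsub>G\<^esub> v"
  shows "\<exists>K\<ge>0. \<forall>g C. 0 \<le> C \<longrightarrow> almost_superharmonic C g \<longrightarrow> g u \<le> K * (C + g v)"
  using assms
proof (induction rule: converse_reachable_induct)
  case base
  show ?case by (rule exI[of _ 1]) auto
next
  case (step x y)
  then obtain K where K: "K \<ge> 0" "\<And>g C. 0 \<le> C \<Longrightarrow> almost_superharmonic C g \<Longrightarrow> g y \<le> K * (C + g v)"
    by blast
  obtain e where e: "e \<in> arcs G" "tail G e = x" "head G e = y"
    using step.hyps(1) by auto
  let ?d = "real (out_degree G y)"
  have "g x \<le> (?d * K + 1) * (C + g v)" if C: "0 \<le> C" and g: "almost_superharmonic C g" for g C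
  proof -
    have y: "y \<in> verts G" using e by auto
    have v: "0 \<le> g v" using g step.hyps(2) by (auto simp: almost_superharmonic_def reachable_in_verts)
    have "g x \<le> (\<Sum>e\<in>in_arcs G y. g (tail G e))"
      using member_le_sum[of e "in_arcs G y" "\<lambda>e. g (tail G e)"] e g
      by (auto simp: almost_superharmonic_def)
    also have "\<dots> \<le> ?d * g y + C"
      using g y by (simp add: almost_superharmonic_def)
    also have "\<dots> \<le> ?d * (K * (C + g v)) + (C + g v)"
      using K(2)[OF C g] v by (intro add_mono mult_left_mono) auto
    finally show ?thesis by (simp add: algebra_simps)
  qed
  moreover have "0 \<le> ?d * K + 1" using K by simp
  ultimately show ?case by blast
qed

lemma harnack:
  obtains K where "K \<ge> 0"
    "\<And>g C u v. \<lbrakk>0 \<le> C; almost_superharmonic C g; u \<in> verts G; v \<in> verts G\<rbrakk> \<Longrightarrow> g u \<le> K * (C + g v)"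
proof -
  have "\<forall>p\<in>verts G \<times> verts G. \<exists>K\<ge>0. \<forall>g C. 0 \<le> C \<longrightarrow> almost_superharmonic C g \<longrightarrow>
      g (fst p) \<le> K * (C + g (snd p))"
    using harnack_pair strongly_connected by (auto simp: strongly_connected_def)
  then obtain k where k: "\<And>p. p \<in> verts G \<times> verts G \<Longrightarrow> k p \<ge> 0 \<and>
      (\<forall>g C. 0 \<le> C \<longrightarrow> almost_superharmonic C g \<longrightarrow> g (fst p) \<le> k p * (C + g (snd p)))"
    by metis
  define K where "K = (\<Sum>p\<in>verts G \<times> verts G. k p)"
  show ?thesis
  proof (rule that[of K])
    show "K \<ge> 0" unfolding K_def using k by (intro sum_nonneg) blast
  next
    fix g C u v assume *: "0 \<le> C" "almost_superharmonic C g" "u \<in> verts G" "v \<in> verts G"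
    then have uv: "(u, v) \<in> verts G \<times> verts G" by simp
    have "g u \<le> k (u, v) * (C + g v)" using k[OF uv] * by auto
    also have "\<dots> \<le> K * (C + g v)"
    proof (rule mult_right_mono)
      show "k (u, v) \<le> K" unfolding K_def
        by (rule member_le_sum[OF uv]) (use k in auto)
      show "0 \<le> C + g v" using * by (simp add: almost_superharmonic_def)
    qed
    finally show "g u \<le> K * (C + g v)" .
  qed
qed

section \<open>The tree frequencies\<close>

definition tree_weight :: "'a \<Rightarrow> real" where
  "tree_weight v = real (num_oriented_spanning_trees G v * out_degree G v)"

definition tree_freq :: "'a \<Rightarrow> real" where
  "tree_freq v = tree_weight v / (\<Sum>w\<in>verts G. tree_weight w)"

lemma tree_weight_pos: "v \<in> verts G \<Longrightarrow> tree_weight v > 0"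
  using num_oriented_spanning_trees_pos out_degree_pos by (simp add: tree_weight_def)

lemma sum_tree_weight_pos: "(\<Sum>w\<in>verts G. tree_weight w) > 0"
  using strongly_connected tree_weight_pos by (intro sum_pos) (auto simp: strongly_connected_def)

lemma tree_weight_balance:
  assumes "v \<in> verts G"
  shows "tree_weight v = (\<Sum>e\<in>in_arcs G v. real (num_oriented_spanning_trees G (tail G e)))"
  using tree_balance[OF assms] by (simp only: tree_weight_def of_nat_sum)

text \<open>
  The smallest multiple of the tree count that dominates \<open>a\<close> touches it at some vertex, and by the
  Harnack inequality it stays close everywhere. The scaling factor is then read off from the sum over
  all vertices.
\<close>
lemma almost_subharmonic_near_tree_freq:
  obtains K where "\<And>a C v. \<lbrakk>0 \<le> C; v \<in> verts G;
      \<And>w. w \<in> verts G \<Longrightarrow> real (out_degree G w) * a w \<le> (\<Sum>e\<in>in_arcs G w. a (tail G e)) + C\<rbrakk>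
    \<Longrightarrow> \<bar>real (out_degree G v) * a v - (\<Sum>w\<in>verts G. real (out_degree G w) * a w) * tree_freq v\<bar> \<le> K * C"
proof -
  obtain K where K: "K \<ge> 0"
    "\<And>g C u v. \<lbrakk>0 \<le> C; almost_superharmonic C g; u \<in> verts G; v \<in> verts G\<rbrakk> \<Longrightarrow> g u \<le> K * (C + g v)"
    by (rule harnack) blast
  let ?T = "\<lambda>v. real (num_oriented_spanning_trees G v)"
  let ?d = "\<lambda>v. real (out_degree G v)"
  define D where "D = (\<Sum>w\<in>verts G. ?d w)"
  let ?Z = "\<Sum>w\<in>verts G. tree_weight w"
  have ne: "verts G \<noteq> {}" using strongly_connected by (simp add: strongly_connected_def)
  have Tpos: "?T w > 0" if "w \<in> verts G" for w
    using num_oriented_spanning_trees_pos[OF that] by simp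
  show ?thesis
  proof (rule that[of "D * K"])
    fix a C v
    assume C: "0 \<le> C" and v: "v \<in> verts G"
      and a: "\<And>w. w \<in> verts G \<Longrightarrow> ?d w * a w \<le> (\<Sum>e\<in>in_arcs G w. a (tail G e)) + C"
    \<comment> \<open>The smallest multiple of the tree count that dominates \<open>a\<close>; it is attained at \<open>v0\<close>.\<close>
    define M where "M = Max ((\<lambda>w. a w / ?T w) ` verts G)"
    have "M \<in> (\<lambda>w. a w / ?T w) ` verts G" unfolding M_def using ne by (intro Max_in) auto
    then obtain v0 where v0: "v0 \<in> verts G" "M = a v0 / ?T v0" by blast
    define g where "g w = M * ?T w - a w" for w
    have g0: "g v0 = 0" using v0 Tpos[OF v0(1)] by (simp add: g_def)
    have g_nonneg: "0 \<le> g w" if w: "w \<in> verts G" for w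
    proof -
      have "a w / ?T w \<le> M" unfolding M_def using w by (intro Max_ge) auto
      then show ?thesis using Tpos[OF w] by (simp add: g_def divide_le_eq)
    qed
    have weight: "?d w * g w = M * tree_weight w - ?d w * a w" for w
      by (simp add: g_def tree_weight_def algebra_simps)
    have "almost_superharmonic C g"
      unfolding almost_superharmonic_def
    proof (intro ballI conjI)
      fix w assume w: "w \<in> verts G"
      have "(\<Sum>e\<in>in_arcs G w. g (tail G e)) = M * tree_weight w - (\<Sum>e\<in>in_arcs G w. a (tail G e))"
        by (simp add: g_def tree_weight_balance[OF w] sum_subtractf sum_distrib_left)
      also have "\<dots> \<le> ?d w * g w + C" using a[OF w] by (simp add: weight)
      finally show "(\<Sum>e\<in>in_arcs G w. g (tail G e)) \<le> ?d w * g w + C" .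
    qed (rule g_nonneg)
    then have g_le: "g w \<le> K * C" if "w \<in> verts G" for w
      using K(2)[where g = g and v = v0, OF C _ that v0(1)] g0 by simp
    define s where "s = (\<Sum>w\<in>verts G. ?d w * g w)"
    have s0: "0 \<le> s" unfolding s_def using g_nonneg by (intro sum_nonneg) simp
    have sD: "s \<le> D * K * C"
    proof -
      have "s \<le> (\<Sum>w\<in>verts G. ?d w * (K * C))"
        unfolding s_def using g_le by (intro sum_mono mult_left_mono) auto
      then show ?thesis by (simp add: D_def sum_distrib_right mult.assoc)
    qed
    have gs: "?d v * g v \<le> s" unfolding s_def
      using v g_nonneg by (intro member_le_sum[where f = "\<lambda>w. ?d w * g w"]) auto
    have g1: "0 \<le> ?d v * g v" using g_nonneg[OF v] by simp
    have freq: "0 \<le> tree_freq v" "tree_freq v \<le> 1"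
    proof -
      have "tree_weight v \<le> ?Z"
        using v tree_weight_pos by (intro member_le_sum) (auto intro: less_imp_le)
      then show "0 \<le> tree_freq v" "tree_freq v \<le> 1"
        using tree_weight_pos[OF v] sum_tree_weight_pos by (simp_all add: tree_freq_def divide_le_eq)
    qed
    have total: "(\<Sum>w\<in>verts G. ?d w * a w) = M * ?Z - s"
      unfolding s_def weight by (simp add: sum_subtractf sum_distrib_left)
    have "tree_weight v = ?Z * tree_freq v"
      using sum_tree_weight_pos by (simp add: tree_freq_def)
    then have local: "?d v * a v = M * (?Z * tree_freq v) - ?d v * g v"
      using weight[of v] by simp
    have "?d v * a v - (\<Sum>w\<in>verts G. ?d w * a w) * tree_freq v = s * tree_freq v - ?d v * g v"
      unfolding total local by (simp add: algebra_simps)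
    moreover have "0 \<le> s * tree_freq v" "s * tree_freq v \<le> s"
      using freq s0 by (auto simp: mult_left_le)
    ultimately show "\<bar>?d v * a v - (\<Sum>w\<in>verts G. ?d w * a w) * tree_freq v\<bar> \<le> D * K * C"
      using gs g1 sD by linarith
  qed
qed

section \<open>The stationary distribution of the simple random walk\<close>

lemma sum_of_bool_mult_delta:
  fixes h :: "'c \<Rightarrow> real"
  assumes "finite A" "b \<in> A"
  shows "(\<Sum>c\<in>A. of_bool (b = c) * h c) = h b"
  using assms by (subst sum.remove[of _ b]) (auto intro!: sum.neutral)

lemma pmf_bind_srw_kernel:
  assumes "set_pmf \<pi> \<subseteq> verts G"
  shows "pmf (bind_pmf \<pi> (srw_kernel G)) w
    = (\<Sum>e\<in>in_arcs G w. pmf \<pi> (tail G e) / real (out_degree G (tail G e)))"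
proof -
  have kernel: "pmf (srw_kernel G v) w = (\<Sum>e\<in>in_arcs G w. of_bool (tail G e = v) / real (out_degree G v))"
    if v: "v \<in> verts G" for v
  proof -
    have "pmf (srw_kernel G v) w = real (card (out_arcs G v \<inter> head G -` {w})) / real (card (out_arcs G v))"
      unfolding srw_kernel_def pmf_map using out_arcs_nonempty[OF v]
      by (simp add: measure_pmf_of_set finite_out_arcs)
    also have "out_arcs G v \<inter> head G -` {w} = {e \<in> in_arcs G w. tail G e = v}" by auto
    also have "real (card \<dots>) = (\<Sum>e\<in>in_arcs G w. of_bool (tail G e = v))"
      by (simp add: finite_in_arcs Int_def)
    finally show ?thesis by (simp add: sum_divide_distrib out_degree_def)
  qed
  have "pmf (bind_pmf \<pi> (srw_kernel G)) w = (\<Sum>v\<in>verts G. pmf (srw_kernel G v) w * pmf \<pi> v)"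
    unfolding pmf_bind using assms by (subst integral_measure_pmf_real[of "verts G"]) auto
  also have "\<dots> = (\<Sum>v\<in>verts G. \<Sum>e\<in>in_arcs G w. of_bool (tail G e = v) * (pmf \<pi> v / real (out_degree G v)))"
    by (intro sum.cong refl) (simp add: kernel sum_distrib_right)
  also have "\<dots> = (\<Sum>e\<in>in_arcs G w. \<Sum>v\<in>verts G. of_bool (tail G e = v) * (pmf \<pi> v / real (out_degree G v)))"
    by (rule sum.swap)
  also have "\<dots> = (\<Sum>e\<in>in_arcs G w. pmf \<pi> (tail G e) / real (out_degree G (tail G e)))"
    by (intro sum.cong refl sum_of_bool_mult_delta) auto
  finally show ?thesis .
qed

lemma srw_invariant_iff:
  "srw_invariant G \<pi> \<longleftrightarrow> set_pmf \<pi> \<subseteq> verts G \<and> (\<forall>w\<in>verts G. pmf \<pi> w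
     = (\<Sum>e\<in>in_arcs G w. pmf \<pi> (tail G e) / real (out_degree G (tail G e))))"
proof -
  have "bind_pmf \<pi> (srw_kernel G) = \<pi> \<longleftrightarrow> (\<forall>w\<in>verts G. pmf \<pi> w
     = (\<Sum>e\<in>in_arcs G w. pmf \<pi> (tail G e) / real (out_degree G (tail G e))))"
    if \<pi>: "set_pmf \<pi> \<subseteq> verts G"
  proof -
    define S where
      "S w = (\<Sum>e\<in>in_arcs G w. pmf \<pi> (tail G e) / real (out_degree G (tail G e)))" for w
    have out: "S w = pmf \<pi> w" if "w \<notin> verts G" for w
    proof -
      have "in_arcs G w = {}" using that by (auto simp: in_arcs_def)
      moreover have "pmf \<pi> w = 0" using that \<pi> by (auto simp: set_pmf_iff)
      ultimately show ?thesis by (simp add: S_def)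
    qed
    have "bind_pmf \<pi> (srw_kernel G) = \<pi> \<longleftrightarrow> (\<forall>w. S w = pmf \<pi> w)"
      by (simp only: pmf_eq_iff pmf_bind_srw_kernel[OF \<pi>] S_def)
    then show ?thesis using out unfolding S_def[symmetric] by metis
  qed
  then show ?thesis unfolding srw_invariant_def by blast
qed

lemma srw_invariant_pmf:
  assumes "srw_invariant G \<pi>" "v \<in> verts G"
  shows "pmf \<pi> v = tree_freq v"
proof -
  have \<pi>: "set_pmf \<pi> \<subseteq> verts G" "\<And>w. w \<in> verts G \<Longrightarrow> pmf \<pi> w
     = (\<Sum>e\<in>in_arcs G w. pmf \<pi> (tail G e) / real (out_degree G (tail G e)))"
    using assms by (auto simp: srw_invariant_iff)
  obtain K where K: "\<And>a C v. \<lbrakk>0 \<le> C; v \<in> verts G;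
      \<And>w. w \<in> verts G \<Longrightarrow> real (out_degree G w) * a w \<le> (\<Sum>e\<in>in_arcs G w. a (tail G e)) + C\<rbrakk>
    \<Longrightarrow> \<bar>real (out_degree G v) * a v - (\<Sum>w\<in>verts G. real (out_degree G w) * a w) * tree_freq v\<bar> \<le> K * C"
    by (rule almost_subharmonic_near_tree_freq) blast
  have cancel: "real (out_degree G w) * (pmf \<pi> w / real (out_degree G w)) = pmf \<pi> w" if "w \<in> verts G" for w
    using out_degree_pos[OF that] by simp
  let ?a = "\<lambda>w. pmf \<pi> w / real (out_degree G w)"
  have "real (out_degree G w) * ?a w \<le> (\<Sum>e\<in>in_arcs G w. ?a (tail G e)) + 0" if "w \<in> verts G" for w
    by (simp only: cancel[OF that] add_0_right order_refl flip: \<pi>(2)[OF that])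
  then have "\<bar>real (out_degree G v) * ?a v - (\<Sum>w\<in>verts G. real (out_degree G w) * ?a w) * tree_freq v\<bar> \<le> K * 0"
    by (intro K assms(2)) auto
  moreover have "(\<Sum>w\<in>verts G. real (out_degree G w) * ?a w) = (\<Sum>w\<in>verts G. pmf \<pi> w)"
    by (intro sum.cong refl cancel)
  moreover have "(\<Sum>w\<in>verts G. pmf \<pi> w) = 1" by (rule sum_pmf_eq_1[OF finite_verts \<pi>(1)])
  ultimately show ?thesis using out_degree_pos[OF assms(2)] by (auto split: if_splits)
qed

lemma ex_srw_invariant: "\<exists>\<pi>. srw_invariant G \<pi>"
proof -
  define p where "p v = (if v \<in> verts G then tree_freq v else 0)" for v
  have p_nonneg: "0 \<le> p v" for v
    using tree_weight_pos[of v] sum_tree_weight_pos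
    by (auto simp: p_def tree_freq_def intro!: divide_nonneg_nonneg less_imp_le)
  have "(\<Sum>v\<in>verts G. p v) = 1"
    using sum_tree_weight_pos by (simp add: p_def tree_freq_def flip: sum_divide_distrib)
  moreover have "(\<integral>\<^sup>+v. ennreal (p v) \<partial>count_space UNIV) = (\<Sum>v\<in>verts G. ennreal (p v))"
    by (intro nn_integral_count_space') (auto simp: p_def)
  ultimately have "(\<integral>\<^sup>+v. ennreal (p v) \<partial>count_space UNIV) = 1"
    using p_nonneg by (simp add: sum_ennreal)
  then have pmf: "pmf (embed_pmf p) v = p v" for v
    using p_nonneg by (intro pmf_embed_pmf) auto
  have "srw_invariant G (embed_pmf p)"
    unfolding srw_invariant_iff
  proof (intro conjI ballI)
    show "set_pmf (embed_pmf p) \<subseteq> verts G" by (auto simp: set_pmf_iff pmf p_def split: if_splits)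
    fix w assume w: "w \<in> verts G"
    let ?Z = "\<Sum>w\<in>verts G. tree_weight w"
    have "p (tail G e) / real (out_degree G (tail G e)) = real (num_oriented_spanning_trees G (tail G e)) / ?Z"
      if "e \<in> in_arcs G w" for e
      using that out_degree_pos[of "tail G e"] by (simp add: p_def tree_freq_def tree_weight_def)
    then have "(\<Sum>e\<in>in_arcs G w. p (tail G e) / real (out_degree G (tail G e))) = tree_weight w / ?Z"
      by (simp add: tree_weight_balance[OF w] sum_divide_distrib)
    then show "pmf (embed_pmf p) w = (\<Sum>e\<in>in_arcs G w. pmf (embed_pmf p) (tail G e) / real (out_degree G (tail G e)))"
      using w by (simp add: pmf p_def tree_freq_def)
  qed
  then show ?thesis ..
qed

lemma ex1_srw_invariant: "\<exists>!\<pi>. srw_invariant G \<pi>"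
proof (rule ex_ex1I[OF ex_srw_invariant])
  fix \<pi> \<pi>' assume *: "srw_invariant G \<pi>" "srw_invariant G \<pi>'"
  show "\<pi> = \<pi>'"
  proof (rule pmf_eqI)
    fix v
    show "pmf \<pi> v = pmf \<pi>' v"
    proof (cases "v \<in> verts G")
      case True
      then show ?thesis using * by (simp add: srw_invariant_pmf)
    next
      case False
      then have "v \<notin> set_pmf \<pi>" "v \<notin> set_pmf \<pi>'" using * by (auto simp: srw_invariant_def)
      then show ?thesis by (simp add: set_pmf_iff)
    qed
  qed
qed

end

section \<open>Counting along a rotor\<close>

definition visits :: "(nat \<Rightarrow> 'c) \<Rightarrow> nat \<Rightarrow> 'c \<Rightarrow> nat" where
  "visits y t c = card {i. i < t \<and> y i = c}"

lemma visits_0 [simp]: "visits y 0 c = 0"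
  by (simp add: visits_def)

lemma visits_Suc [simp]: "visits y (Suc t) c = visits y t c + of_bool (y t = c)"
proof -
  have "{i. i < Suc t \<and> y i = c} = {i. i < t \<and> y i = c} \<union> (if y t = c then {t} else {})"
    by (auto simp: less_Suc_eq)
  then show ?thesis by (simp add: visits_def)
qed

lemma sum_of_bool_eq: "finite A \<Longrightarrow> (\<Sum>c\<in>A. of_bool (b = c)) = (of_bool (b \<in> A) :: nat)"
  by (induction A rule: finite_induct) auto

lemma sum_visits:
  assumes "finite A" "\<And>i. y i \<in> A"
  shows "(\<Sum>c\<in>A. visits y t c) = t"
  using assms by (induction t) (auto simp: sum.distrib sum_of_bool_eq)

text \<open>
  The distance still to go to \<open>e\<close> drops by one with each step of the cycle, except at \<open>e\<close> itself,
  where it jumps from 0 to one less than the length of the cycle. It serves as a potential that turns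
  the evenness of a rotor into a conservation law.
\<close>
lemma funpow_dist_cyclic_step:
  assumes f: "cyclic_on f S" and a: "a \<in> S" and e: "e \<in> S"
  shows "card S * of_bool (a = e) + funpow_dist f a e = 1 + funpow_dist f (f a) e"
proof (cases "a = e")
  case True
  have orb: "orbit f e = S" using orbit_cyclic_eq3[OF f e] .
  have "card S = card ((\<lambda>n. (f ^^ n) e) ` {0..<funpow_dist1 f e e})"
    using orbit_conv_funpow_dist1[of e f] e orb by simp
  also have "\<dots> = funpow_dist1 f e e"
    using e orb by (subst card_image[OF inj_on_funpow_dist1]) auto
  finally show ?thesis using True by (simp add: funpow_dist_0)
next
  case False
  then show ?thesis
    using funpow_dist_step[of a e f] orbit_cyclic_eq3[OF f a] e by simp
qed

lemma funpow_dist_cyclic_le: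
  assumes f: "cyclic_on f S" and a: "a \<in> S" and e: "e \<in> S"
  shows "funpow_dist f a e \<le> card S"
proof -
  have "inj_on (\<lambda>n. (f ^^ n) a) {0..funpow_dist f a e}"
    using orbit_cyclic_eq3[OF f a] e by (intro inj_on_funpow_dist) simp
  moreover have "(\<lambda>n. (f ^^ n) a) ` {0..funpow_dist f a e} \<subseteq> S"
    using cyclic_on_funpow_in[OF f a] by blast
  ultimately have "card {0..funpow_dist f a e} \<le> card S"
    using finite_cyclic_on[OF f] by (intro card_inj_on_le)
  then show ?thesis by simp
qed

section \<open>Rotor walks\<close>

context strong_digraph
begin

text \<open>
  The sequence \<open>y\<close> consists of the arcs that the chip traverses. For an arc \<open>e\<close> out of \<open>v\<close>, the
  quantity \<open>d v\<close> times the uses of \<open>e\<close> minus the visits to \<open>v\<close> changes exactly as the potential of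
  the rotor at \<open>v\<close>, which lies between 0 and \<open>d v\<close>.
\<close>
lemma rotor_walkE:
  assumes order: "rotor_order G next_arc" and walk: "rotor_walk G next_arc x"
  obtains y where "\<And>i. y i \<in> out_arcs G (x i)" "\<And>i. x (Suc i) = head G (y i)"
    "\<And>e t. e \<in> arcs G \<Longrightarrow>
      \<bar>real (visits y t e) - real (visits x t (tail G e)) / real (out_degree G (tail G e))\<bar> \<le> 1"
proof -
  obtain \<sigma> where \<sigma>: "\<sigma> \<in> rotor_states G" and x: "\<And>i. x i = fst ((rotor_step G next_arc ^^ i) \<sigma>)"
    using walk by (auto simp: rotor_walk_def)
  define \<rho> where "\<rho> i = snd ((rotor_step G next_arc ^^ i) \<sigma>)" for i
  define y where "y i = next_arc (\<rho> i (x i))" for i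
  have cyc: "cyclic_on next_arc (out_arcs G v)" if "v \<in> verts G" for v
    using order that by (simp add: rotor_order_def)
  have state: "(rotor_step G next_arc ^^ i) \<sigma> = (x i, \<rho> i)" for i
    by (simp add: x \<rho>_def)
  have "(x (Suc i), \<rho> (Suc i)) = rotor_step G next_arc (x i, \<rho> i)" for i
    using state[of "Suc i"] by (simp add: state)
  then have x_Suc: "x (Suc i) = head G (y i)" and \<rho>_Suc: "\<rho> (Suc i) = (\<rho> i)(x i := y i)" for i
    by (simp_all add: rotor_step_def y_def)
  have inv: "x i \<in> verts G \<and> (\<forall>v\<in>verts G. \<rho> i v \<in> out_arcs G v)" for i
  proof (induction i)
    case 0
    show ?case using \<sigma> state[of 0] by (auto simp: rotor_states_def rotor_config_def)
  next
    case (Suc i)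
    then have "y i \<in> out_arcs G (x i)"
      unfolding y_def by (intro cyclic_on_inI[OF cyc]) auto
    with Suc show ?case by (auto simp: x_Suc \<rho>_Suc)
  qed
  have y: "y i \<in> out_arcs G (x i)" for i
    unfolding y_def using inv by (intro cyclic_on_inI[OF cyc]) auto
  have "\<bar>real (visits y t e) - real (visits x t v) / real (out_degree G v)\<bar> \<le> 1"
    if e: "e \<in> arcs G" and ve: "v = tail G e" for e v t
  proof -
    have v: "v \<in> verts G" and e_out: "e \<in> out_arcs G v" using e ve by auto
    let ?S = "out_arcs G v"
    \<comment> \<open>The rotor is advanced before it is used, so its potential is taken one step ahead.\<close>
    let ?\<phi> = "\<lambda>t. funpow_dist next_arc (next_arc (\<rho> t v)) e"
    have in_S: "next_arc (\<rho> t v) \<in> ?S" for t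
      using inv v by (intro cyclic_on_inI[OF cyc]) auto
    have "card ?S * visits y t e + ?\<phi> 0 = visits x t v + ?\<phi> t" for t
    proof (induction t)
      case (Suc t)
      show ?case
      proof (cases "x t = v")
        case True
        then have "\<rho> (Suc t) v = y t" "next_arc (\<rho> t v) = y t" by (auto simp: \<rho>_Suc y_def)
        then show ?thesis
          using Suc True funpow_dist_cyclic_step[OF cyc[OF v] in_S[of t] e_out]
          by (simp add: algebra_simps)
      next
        case False
        then have "y t \<noteq> e" "\<rho> (Suc t) v = \<rho> t v" using y[of t] e_out by (auto simp: \<rho>_Suc)
        with Suc False show ?thesis by simp
      qed
    qed simp
    then have "real (card ?S) * real (visits y t e) + real (?\<phi> 0) = real (visits x t v) + real (?\<phi> t)"
      by (metis of_nat_add of_nat_mult)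
    moreover have "real (?\<phi> 0) \<le> card ?S" "real (?\<phi> t) \<le> card ?S"
      using funpow_dist_cyclic_le[OF cyc[OF v] in_S e_out] by auto
    moreover have d: "0 < real (card ?S)" using out_degree_pos[OF v] by (simp add: out_degree_def)
    ultimately have "\<bar>real (card ?S) * real (visits y t e) - real (visits x t v)\<bar> \<le> real (card ?S)"
      by linarith
    moreover have "real (visits y t e) - real (visits x t v) / real (card ?S)
      = (real (card ?S) * real (visits y t e) - real (visits x t v)) / real (card ?S)"
      using d by (simp add: field_simps)
    ultimately show ?thesis using d by (simp add: out_degree_def abs_divide)
  qed
  then show ?thesis using that y x_Suc by blast
qed

text \<open>
  The visits are balanced up to an error bounded in time, so the stability of the balance equations
  applies with one constant for all \<open>t\<close>.
\<close>
lemma rotor_walk_bounded_discrepancy: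
  assumes order: "rotor_order G next_arc" and walk: "rotor_walk G next_arc x"
  obtains B where "\<And>t v. v \<in> verts G \<Longrightarrow> \<bar>real (visits x t v) - real t * tree_freq v\<bar> \<le> B"
proof -
  obtain y where y: "\<And>i. y i \<in> out_arcs G (x i)" and x_Suc: "\<And>i. x (Suc i) = head G (y i)"
    and arc: "\<And>e t. e \<in> arcs G \<Longrightarrow>
      \<bar>real (visits y t e) - real (visits x t (tail G e)) / real (out_degree G (tail G e))\<bar> \<le> 1"
    by (rule rotor_walkE[OF order walk]) blast
  obtain K where K: "\<And>a C v. \<lbrakk>0 \<le> C; v \<in> verts G;
      \<And>w. w \<in> verts G \<Longrightarrow> real (out_degree G w) * a w \<le> (\<Sum>e\<in>in_arcs G w. a (tail G e)) + C\<rbrakk>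
    \<Longrightarrow> \<bar>real (out_degree G v) * a v - (\<Sum>w\<in>verts G. real (out_degree G w) * a w) * tree_freq v\<bar> \<le> K * C"
    by (rule almost_subharmonic_near_tree_freq) blast
  \<comment> \<open>One unit of error for each arc and one for the two ends of the time interval.\<close>
  let ?C = "1 + real (card (arcs G))"
  \<comment> \<open>The visits of times \<open>1..t\<close> are the arrivals; those of times \<open>0..<t\<close> differ at the two ends.\<close>
  have arrivals: "(\<Sum>e\<in>in_arcs G w. visits y t e) + of_bool (x 0 = w) = visits x t w + of_bool (x t = w)" for w t
  proof (induction t)
    case (Suc t)
    have "y t \<in> in_arcs G w \<longleftrightarrow> x (Suc t) = w" using y[of t] x_Suc[of t] by auto
    with Suc show ?case by (simp add: sum.distrib sum_of_bool_eq finite_in_arcs)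
  qed simp
  have "\<bar>real (visits x t v) - real t * tree_freq v\<bar> \<le> K * ?C" if v: "v \<in> verts G" for t v
  proof -
    let ?a = "\<lambda>w. real (visits x t w) / real (out_degree G w)"
    have cancel: "real (out_degree G w) * ?a w = real (visits x t w)" if "w \<in> verts G" for w
      using out_degree_pos[OF that] by simp
    have "real (out_degree G w) * ?a w \<le> (\<Sum>e\<in>in_arcs G w. ?a (tail G e)) + ?C" if w: "w \<in> verts G" for w
    proof -
      have "real (visits x t w) \<le> real ((\<Sum>e\<in>in_arcs G w. visits y t e) + 1)"
        unfolding of_nat_le_iff using arrivals[where w = w and t = t] by (auto split: if_splits simp: of_bool_def)
      also have "\<dots> \<le> (\<Sum>e\<in>in_arcs G w. ?a (tail G e) + 1) + 1"
      proof -
        have "real (visits y t e) \<le> ?a (tail G e) + 1" if "e \<in> in_arcs G w" for e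
          using arc[of e t] that by (simp add: abs_le_iff)
        then show ?thesis unfolding of_nat_add of_nat_sum by (intro add_mono sum_mono) auto
      qed
      also have "\<dots> = (\<Sum>e\<in>in_arcs G w. ?a (tail G e)) + (1 + real (card (in_arcs G w)))"
        by (simp add: sum.distrib)
      also have "\<dots> \<le> (\<Sum>e\<in>in_arcs G w. ?a (tail G e)) + ?C"
        by (intro add_left_mono of_nat_mono card_mono) (auto simp: in_arcs_def)
      finally show ?thesis by (simp only: cancel[OF w])
    qed
    then have "\<bar>real (out_degree G v) * ?a v - (\<Sum>w\<in>verts G. real (out_degree G w) * ?a w) * tree_freq v\<bar> \<le> K * ?C"
      by (intro K v) auto
    moreover have "(\<Sum>w\<in>verts G. real (out_degree G w) * ?a w) = real (\<Sum>w\<in>verts G. visits x t w)"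
      using cancel by (simp add: of_nat_sum)
    moreover have "x i \<in> verts G" for i using y[of i] tail_in_verts[of "y i"] by simp
    then have "(\<Sum>w\<in>verts G. visits x t w) = t" by (intro sum_visits) auto
    ultimately show ?thesis by (simp only: cancel[OF v])
  qed
  then show ?thesis using that by blast
qed

lemma rotor_walk_frequency:
  assumes "rotor_order G next_arc" "rotor_walk G next_arc x" and v: "v \<in> verts G"
  shows "(\<lambda>t. 1 / real t * real (visits x t v)) \<longlonglongrightarrow> tree_freq v"
proof -
  obtain B where B: "\<And>t. \<bar>real (visits x t v) - real t * tree_freq v\<bar> \<le> B"
    using rotor_walk_bounded_discrepancy[OF assms(1,2)] v by metis
  have "\<forall>\<^sub>F t in sequentially. norm (1 / real t * real (visits x t v) - tree_freq v) \<le> B / real t"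
    using eventually_gt_at_top[of 0]
  proof eventually_elim
    case (elim t)
    then have "1 / real t * real (visits x t v) - tree_freq v
        = (real (visits x t v) - real t * tree_freq v) / real t"
      by (simp add: field_simps)
    then show ?case using B[of t] elim by (simp add: abs_divide divide_right_mono)
  qed
  then have "(\<lambda>t. 1 / real t * real (visits x t v) - tree_freq v) \<longlonglongrightarrow> 0"
    by (rule Lim_null_comparison) (rule lim_const_over_n)
  then show ?thesis by (simp add: LIM_zero_iff)
qed

end

theorem mainTheorem3:
  fixes G :: "('a, 'b) pre_digraph"
    and next_arc :: "'b \<Rightarrow> 'b"
    and x :: "nat \<Rightarrow> 'a"
  assumes "fin_digraph G"
    and "strongly_connected G"
    and "arcs G \<noteq> {}"
    and "rotor_order G next_arc"
    and "rotor_walk G next_arc x"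
  shows "(\<exists>!\<pi>. srw_invariant G \<pi>) \<and>
    (\<forall>v \<in> verts G.
      (\<lambda>t. 1 / real t * real (card {i. i < t \<and> x i = v})) \<longlonglongrightarrow>
        real (num_oriented_spanning_trees G v * out_degree G v) /
        real (\<Sum>w \<in> verts G. num_oriented_spanning_trees G w * out_degree G w) \<and>
      real (num_oriented_spanning_trees G v * out_degree G v) /
        real (\<Sum>w \<in> verts G. num_oriented_spanning_trees G w * out_degree G w) =
        pmf (srw_stationary G) v)"
proof -
  interpret strong_digraph G
    using assms by (simp add: strong_digraph_def strong_digraph_axioms_def)
  have freq: "real (num_oriented_spanning_trees G v * out_degree G v) /
      real (\<Sum>w \<in> verts G. num_oriented_spanning_trees G w * out_degree G w) = tree_freq v" for v
    by (simp only: tree_freq_def tree_weight_def of_nat_sum)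
  have "srw_invariant G (srw_stationary G)"
    unfolding srw_stationary_def by (rule theI'[OF ex1_srw_invariant])
  then show ?thesis
    unfolding freq using ex1_srw_invariant srw_invariant_pmf
      rotor_walk_frequency[OF assms(4,5), unfolded visits_def] by simp
qed

end
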